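(* Let $X\subseteq\mathbb{R}^d$ be bounded and let $(X,\mathcal{B},\mu,T)$ be a measure-preserving system. Suppose that $\mu$ has exponential decay of correlations with respect to $\mathcal{C}^{\beta}(X)$ for some $0<\beta\le1$. Let $\mathcal{C}$ be a collection of $\mu$-measurable subsets of $\mathbb{R}^d$ and suppose there exist constants $C>0$ and $\delta>0$ such that $$\mu\big((\partial E)_{\varrho}\big)\le C\,\varrho^{\delta}\qquad\text{for all }\varrho>0\text{ and all }E\in\mathcal{C}.$$ Then $\mu$ is exponentially mixing with respect to $(T,\mathcal{C})$.
   Context: A measure-preserving system $(X,\mathcal{B},\mu,T)$ consists of a probability space $(X,\mathcal{B},\mu)$ and a measurable map $T:X\to X$ with $\mu(T^{-1}E)=\mu(E)$ for all $E\in\mathcal{B}$. Here $X\subseteq\mathbb{R}^d$, $\mathcal{B}$ contains the Borel subsets of $X$, and $\mu$ is regarded as a measure on $\mathbb{R}^d$ via $\mu(E)=\mu(E\cap X)$. $\mathcal{C}^\beta(X)$ is the space of $\beta$-Hölder continuous real functions on $X$ with the $\beta$-Hölder norm $\|f\|_\beta=\sup_X|f|+\sup_{x\ne y\in X}|f(x)-f(y)|/|x-y|^\beta$. $\mu$ has exponential decay of correlations with respect to $\mathcal{C}^\beta(X)$ if there exist $C>0$ and $0<\gamma<1$ such that $$\Big|\int_X f_1\cdot f_2\circ T^n\,d\mu-\int_X f_1\,d\mu\int_X f_2\,d\mu\Big|\le C\gamma^n\|f_1\|_\beta\int_X|f_2|\,d\mu$$ for all $n\in\mathbb{N}$, $f_1\in\mathcal{C}^\beta(X)$,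 $f_2\in L^1(\mu)$. Exponential mixing: put $\phi(n)=\sup\{|\mu(E\cap T^{-n}F)/\mu(F)-\mu(E)|:E\in\mathcal{C},\ F\in\mathcal{B},\ \mu(F)>0\}$. $\mu$ is exponentially mixing with respect to $(T,\mathcal{C})$ if there is $\gamma\in(0,1)$ with $\phi(n)=O(\gamma^n)$. $\partial E$ is the topological boundary of $E$ in $\mathbb{R}^d$ and $(E)_\varrho=\{x\in\mathbb{R}^d:\inf_{y\in E}|x-y|<\varrho\}$ (Euclidean norm). *)

theory Defs
  imports "HOL-Probability.Probability" "HOL-Library.Landau_Symbols"
begin

text \<open>The sigma-algebra of the system is \<open>sets M\<close> and its space is \<open>X = space M\<close>, which need not be
  Borel in the ambient space; accordingly the Borel subsets of \<open>X\<close> are taken relative to \<open>X\<close>.\<close>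

definition measure_preserving_system ::
    "'a::euclidean_space set \<Rightarrow> 'a measure \<Rightarrow> ('a \<Rightarrow> 'a) \<Rightarrow> bool" where
  "measure_preserving_system X M T \<longleftrightarrow>
     prob_space M \<and> space M = X \<and> sets (restrict_space borel X) \<subseteq> sets M \<and>
     T \<in> measurable M M \<and> (\<forall>E\<in>sets M. emeasure M (T -` E \<inter> X) = emeasure M E)"

text \<open>The measure of the system regarded as a measure on the ambient space.\<close>

definition ambient_measure :: "'a measure \<Rightarrow> 'a set \<Rightarrow> real" where
  "ambient_measure M E = measure M (E \<inter> space M)"

definition ambient_measurable :: "'a measure \<Rightarrow> 'a set \<Rightarrow> bool" where
  "ambient_measurable M E \<longleftrightarrow> E \<inter> space M \<in> sets M"

text \<open>Functions on \<open>X\<close> are represented by functions on the whole type whose values outside \<open>X\<close> are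
  irrelevant. Boundedness, needed for the norm to be finite, is automatic when \<open>X\<close> is bounded.\<close>

definition holder_space :: "real \<Rightarrow> 'a::euclidean_space set \<Rightarrow> ('a \<Rightarrow> real) set" where
  "holder_space \<beta> X = {f. bounded (f ` X) \<and>
     (\<exists>L. \<forall>x\<in>X. \<forall>y\<in>X. \<bar>f x - f y\<bar> \<le> L * norm (x - y) powr \<beta>)}"

text \<open>Here and in \<open>mixing_coeff\<close> the suprema are over sets of nonnegative reals which may be empty
  (if \<open>X\<close> is a singleton, respectively if the collection is empty). As \<open>Sup {}\<close> is unspecified on
  the reals, inserting 0 fixes the convention that the empty supremum is 0 and changes nothing
  otherwise.\<close>

definition holder_norm :: "real \<Rightarrow> 'a::euclidean_space set \<Rightarrow> ('a \<Rightarrow> real) \<Rightarrow> real" where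
  "holder_norm \<beta> X f =
     (SUP x\<in>X. \<bar>f x\<bar>) +
     Sup (insert 0 {\<bar>f x - f y\<bar> / norm (x - y) powr \<beta> | x y. x \<in> X \<and> y \<in> X \<and> x \<noteq> y})"

definition exp_decay_of_correlations ::
    "'a::euclidean_space measure \<Rightarrow> ('a \<Rightarrow> 'a) \<Rightarrow> real \<Rightarrow> bool" where
  "exp_decay_of_correlations M T \<beta> \<longleftrightarrow>
     (\<exists>C>0. \<exists>\<gamma>. 0 < \<gamma> \<and> \<gamma> < 1 \<and>
        (\<forall>n::nat. \<forall>f1\<in>holder_space \<beta> (space M). \<forall>f2. integrable M f2 \<longrightarrow>
           \<bar>(\<integral>x. f1 x * f2 ((T ^^ n) x) \<partial>M) - (\<integral>x. f1 x \<partial>M) * (\<integral>x. f2 x \<partial>M)\<bar>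
             \<le> C * \<gamma> ^ n * holder_norm \<beta> (space M) f1 * (\<integral>x. \<bar>f2 x\<bar> \<partial>M)))"

definition mixing_coeff ::
    "'a measure \<Rightarrow> ('a \<Rightarrow> 'a) \<Rightarrow> 'a set set \<Rightarrow> nat \<Rightarrow> real" where
  "mixing_coeff M T \<C> n =
     Sup (insert 0
       {\<bar>ambient_measure M (E \<inter> ((T ^^ n) -` F \<inter> space M)) / measure M F - ambient_measure M E\<bar>
        | E F. E \<in> \<C> \<and> F \<in> sets M \<and> measure M F > 0})"

definition exp_mixing :: "'a measure \<Rightarrow> ('a \<Rightarrow> 'a) \<Rightarrow> 'a set set \<Rightarrow> bool" where
  "exp_mixing M T \<C> \<longleftrightarrow> (\<exists>\<gamma>. 0 < \<gamma> \<and> \<gamma> < 1 \<and> mixing_coeff M T \<C> \<in> O(\<lambda>n. \<gamma> ^ n))"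

text \<open>The infimum is taken in the extended reals so that the neighbourhood of the empty set is
  empty; \<open>infdist\<close> would give the whole space instead.\<close>

definition open_nbhd :: "'a::euclidean_space set \<Rightarrow> real \<Rightarrow> 'a set" where
  "open_nbhd E \<rho> = {x. (INF y\<in>E. ereal (norm (x - y))) < ereal \<rho>}"

end

theory Submission
  imports Defs
begin

text \<open>The indicator function of a set \<open>E\<close> need not be Hoelder continuous, so decay of correlations
  cannot be applied to it directly. It is replaced by a tent function \<open>f\<close> of width \<open>\<rho>\<close> that lies
  above it, equals 1 on \<open>E\<close> and vanishes at distance \<open>\<rho>\<close> or more from \<open>E\<close>. The cost of the
  replacement is \<open>\<integral>f d\<mu> - \<mu>(E)\<close>; since a segment that leaves a nonempty set \<open>E\<close> crosses its
  boundary, the two functions differ only on \<open>(\<partial>E)\<^sub>\<rho>\<close>, and the cost is at most \<open>C \<rho>\<^sup>\<delta>\<close>. On the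
  other hand the Hoelder norm of \<open>f\<close> is at most \<open>1 + \<rho>\<^bsup>-\<beta>\<^esup>\<close>. Decay of correlations for \<open>f\<close> and the
  indicator function of \<open>F\<close> then gives
  \<open>\<mu>(E \<inter> T\<^bsup>-n\<^esup>F) / \<mu>(F) - \<mu>(E) \<le> C \<rho>\<^sup>\<delta> + D \<gamma>\<^sup>n (1 + \<rho>\<^bsup>-\<beta>\<^esup>)\<close>
  uniformly in \<open>E\<close> and \<open>F\<close> (\<open>measure_Int_preimage_le\<close>). The choice \<open>\<rho> = \<gamma> powr (n / (2 \<beta>))\<close> spends
  half of the exponential rate on the norm of the tent function and leaves both terms exponentially
  small in \<open>n\<close> (\<open>balanced_scale\<close>).

  This is only an upper bound, but a set and its complement have the same boundary, and passing to
  the complement changes the sign of the left-hand side; so the upper bound for the complement is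
  the lower bound for the set (\<open>abs_measure_Int_preimage_le\<close>).\<close>

section \<open>Neighbourhoods of the boundary\<close>

lemma open_nbhd_eq_UN_ball: "open_nbhd A r = (\<Union>y\<in>A. ball y r)"
  by (auto simp: open_nbhd_def INF_less_iff dist_norm norm_minus_commute)

text \<open>The segment from \<open>x\<close> to a nearby point of \<open>E\<close> crosses the boundary of \<open>E\<close>.\<close>

lemma infdist_less_imp_near_frontier:
  fixes E :: "'a::euclidean_space set"
  assumes "x \<notin> E" "E \<noteq> {}" "infdist x E < r"
  shows "x \<in> open_nbhd (frontier E) r"
proof -
  obtain e where e: "e \<in> E" "dist x e < r"
    using assms by (auto simp: infdist_def cINF_less_iff split: if_splits)
  have "closed_segment x e \<inter> frontier E \<noteq> {}"
    by (rule connected_Int_frontier) (use assms e in auto)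
  then obtain z where z: "z \<in> closed_segment x e" "z \<in> frontier E"
    by blast
  have "dist z x \<le> dist x e"
    using dist_in_closed_segment[OF z(1)] by (simp add: dist_commute)
  with e z show ?thesis
    by (auto simp: open_nbhd_eq_UN_ball intro!: bexI[of _ z])
qed

section \<open>Tent functions\<close>

definition tent :: "'a::euclidean_space set \<Rightarrow> real \<Rightarrow> 'a \<Rightarrow> real" where
  "tent E r x = max 0 (1 - infdist x E / r)"

lemma tent_nonneg: "0 \<le> tent E r x"
  by (simp add: tent_def)

lemma tent_le_1: "r > 0 \<Longrightarrow> tent E r x \<le> 1"
  by (simp add: tent_def infdist_nonneg)

lemma tent_eq_1: "x \<in> E \<Longrightarrow> tent E r x = 1"
  by (simp add: tent_def)

lemma abs_tent_le_1: "r > 0 \<Longrightarrow> \<bar>tent E r x\<bar> \<le> 1"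
  using tent_nonneg[of E r x] tent_le_1[of r E x] by simp

lemma tent_le_indicator_add:
  fixes E :: "'a::euclidean_space set"
  assumes "r > 0" "E \<noteq> {}"
  shows "tent E r x \<le> indicator E x + indicator (open_nbhd (frontier E) r) x"
proof (cases "x \<in> E \<or> x \<in> open_nbhd (frontier E) r")
  case True
  then show ?thesis
    using tent_le_1[OF assms(1), of E x] by (auto simp: indicator_def)
next
  case False
  with infdist_less_imp_near_frontier[of x E r] assms have "r \<le> infdist x E"
    by fastforce
  with assms False show ?thesis by (simp add: tent_def)
qed

text \<open>The tent function is Lipschitz with constant \<open>1 / r\<close> and takes values in the unit interval, and
  \<open>min 1 t \<le> t powr \<beta>\<close> for every \<open>t \<ge> 0\<close> because \<open>0 < \<beta> \<le> 1\<close>.\<close>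

lemma tent_holder:
  fixes E :: "'a::euclidean_space set"
  assumes "r > 0" "0 < \<beta>" "\<beta> \<le> 1"
  shows "\<bar>tent E r x - tent E r y\<bar> \<le> r powr - \<beta> * norm (x - y) powr \<beta>"
proof -
  define t where "t = norm (x - y) / r"
  have t0: "t \<ge> 0" using assms by (simp add: t_def)
  have "\<bar>tent E r x - tent E r y\<bar> \<le> \<bar>infdist x E / r - infdist y E / r\<bar>"
    by (simp add: tent_def)
  also have "\<dots> = \<bar>infdist x E - infdist y E\<bar> / r"
    using assms by (simp flip: diff_divide_distrib)
  also have "\<dots> \<le> t"
    using infdist_triangle_abs[of x E y] assms by (simp add: t_def dist_norm divide_right_mono)
  finally have lip: "\<bar>tent E r x - tent E r y\<bar> \<le> t" .
  have le1: "\<bar>tent E r x - tent E r y\<bar> \<le> 1"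
    using tent_nonneg[of E r x] tent_nonneg[of E r y] tent_le_1[OF assms(1), of E x]
      tent_le_1[OF assms(1), of E y] by linarith
  have "\<bar>tent E r x - tent E r y\<bar> \<le> t powr \<beta>"
  proof (cases "t \<le> 1")
    case True
    show ?thesis
    proof (cases "t = 0")
      case False
      then have "t powr 1 \<le> t powr \<beta>"
        using True t0 assms by (intro powr_mono') auto
      with lip t0 False show ?thesis by simp
    qed (use lip in simp)
  next
    case False
    then have "1 \<le> t powr \<beta>" using assms by (simp add: ge_one_powr_ge_zero)
    with le1 show ?thesis by simp
  qed
  also have "t powr \<beta> = r powr - \<beta> * norm (x - y) powr \<beta>"
    using assms by (simp add: t_def powr_divide powr_minus field_simps)
  finally show ?thesis .
qed

lemma tent_in_holder_space:
  assumes "r > 0" "0 < \<beta>" "\<beta> \<le> 1"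
  shows "tent E r \<in> holder_space \<beta> X"
proof -
  have "bounded (tent E r ` X)"
    unfolding bounded_iff using abs_tent_le_1[OF assms(1)] by fastforce
  moreover have "\<exists>L. \<forall>x\<in>X. \<forall>y\<in>X. \<bar>tent E r x - tent E r y\<bar> \<le> L * norm (x - y) powr \<beta>"
    using tent_holder[OF assms] by blast
  ultimately show ?thesis by (simp add: holder_space_def)
qed

lemma holder_norm_tent_le:
  assumes "r > 0" "0 < \<beta>" "\<beta> \<le> 1" "X \<noteq> {}"
  shows "holder_norm \<beta> X (tent E r) \<le> 1 + r powr - \<beta>"
proof -
  have "(SUP x\<in>X. \<bar>tent E r x\<bar>) \<le> 1"
    using assms abs_tent_le_1[OF assms(1)] by (intro cSUP_least) auto
  moreover have "Sup (insert 0 {\<bar>tent E r x - tent E r y\<bar> / norm (x - y) powr \<beta>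
      | x y. x \<in> X \<and> y \<in> X \<and> x \<noteq> y}) \<le> r powr - \<beta>"
  proof (rule cSup_least)
    fix q
    assume "q \<in> insert 0 {\<bar>tent E r x - tent E r y\<bar> / norm (x - y) powr \<beta>
      | x y. x \<in> X \<and> y \<in> X \<and> x \<noteq> y}"
    then consider "q = 0"
      | x y where "x \<noteq> y" "q = \<bar>tent E r x - tent E r y\<bar> / norm (x - y) powr \<beta>"
      by blast
    then show "q \<le> r powr - \<beta>"
      using tent_holder[OF assms(1-3), of E] by cases (auto simp: divide_le_eq)
  qed simp
  ultimately show ?thesis unfolding holder_norm_def by linarith
qed

section \<open>Correlations of sets with small boundary\<close>

lemma borel_measurable_of_ambient:
  assumes "measure_preserving_system X M T" "f \<in> borel_measurable borel"
  shows "f \<in> borel_measurable M"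
proof (rule measurableI)
  fix A :: "'b set"
  assume A: "A \<in> sets borel"
  have "f -` A \<in> sets borel"
    using measurable_sets[OF assms(2) A] by simp
  then have "f -` A \<inter> X \<in> sets (restrict_space borel X)"
    by (auto simp: sets_restrict_space)
  then show "f -` A \<inter> space M \<in> sets M"
    using assms(1) unfolding measure_preserving_system_def by blast
qed simp

lemma borel_measurable_tent:
  assumes "measure_preserving_system X M T" "r > 0"
  shows "tent E r \<in> borel_measurable M"
  unfolding tent_def
  by (rule borel_measurable_of_ambient[OF assms(1)])
    (intro borel_measurable_continuous_onI continuous_intros, use assms in auto)

lemma ambient_measurable_open_nbhd:
  assumes "measure_preserving_system X M T"
  shows "ambient_measurable M (open_nbhd A r)"
proof -
  have "open_nbhd A r \<in> sets borel"
    unfolding open_nbhd_eq_UN_ball by (intro borel_open open_UN) auto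
  then have "open_nbhd A r \<inter> X \<in> sets (restrict_space borel X)"
    by (auto simp: sets_restrict_space)
  then show ?thesis
    using assms unfolding ambient_measurable_def measure_preserving_system_def by blast
qed

lemma measurable_funpow: "T \<in> measurable M M \<Longrightarrow> (T ^^ n) \<in> measurable M M"
  by (induction n) (auto simp: id_def intro: measurable_comp)

lemma integral_tent_le:
  assumes "measure_preserving_system X M T" "ambient_measurable M E" "r > 0" "E \<noteq> {}"
  shows "(\<integral>x. tent E r x \<partial>M) \<le> ambient_measure M E + ambient_measure M (open_nbhd (frontier E) r)"
proof -
  interpret prob_space M
    using assms(1) by (simp add: measure_preserving_system_def)
  let ?N = "open_nbhd (frontier E) r"
  have N: "?N \<inter> space M \<in> sets M" and E: "E \<inter> space M \<in> sets M"
    using ambient_measurable_open_nbhd[OF assms(1)] assms(2) by (auto simp: ambient_measurable_def)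
  have "tent E r \<in> borel_measurable M"
    using assms by (intro borel_measurable_tent)
  then have int: "integrable M (tent E r)"
    using assms(3) abs_tent_le_1 by (intro integrable_const_bound[where B = 1]) auto
  have "(\<integral>x. tent E r x \<partial>M)
      \<le> (\<integral>x. indicator (E \<inter> space M) x + indicator (?N \<inter> space M) x \<partial>M)"
  proof (rule integral_mono[OF int])
    show "tent E r x \<le> indicator (E \<inter> space M) x + indicator (?N \<inter> space M) x"
      if "x \<in> space M" for x
      using tent_le_indicator_add[OF assms(3,4), of x] that by (simp add: indicator_def)
  qed (use E N in \<open>auto simp: emeasure_eq_measure\<close>)
  also have "\<dots> = ambient_measure M E + ambient_measure M ?N"
    using E N by (subst Bochner_Integration.integral_add)
      (auto simp: emeasure_eq_measure ambient_measure_def)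
  finally show ?thesis .
qed

text \<open>Decay of correlations with its constants named, so that the estimates below can be seen to be
  uniform in the two sets.\<close>

definition correlation_bound :: "'a::euclidean_space measure \<Rightarrow> ('a \<Rightarrow> 'a) \<Rightarrow> real \<Rightarrow> real \<Rightarrow> real \<Rightarrow> bool"
  where "correlation_bound M T \<beta> D \<gamma> \<longleftrightarrow>
    (\<forall>n::nat. \<forall>f1\<in>holder_space \<beta> (space M). \<forall>f2. integrable M f2 \<longrightarrow>
       \<bar>(\<integral>x. f1 x * f2 ((T ^^ n) x) \<partial>M) - (\<integral>x. f1 x \<partial>M) * (\<integral>x. f2 x \<partial>M)\<bar>
         \<le> D * \<gamma> ^ n * holder_norm \<beta> (space M) f1 * (\<integral>x. \<bar>f2 x\<bar> \<partial>M))"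

lemma measure_Int_preimage_le:
  fixes M :: "'a::euclidean_space measure"
  assumes mps: "measure_preserving_system X M T" and E: "ambient_measurable M E"
    and corr: "correlation_bound M T \<beta> D \<gamma>" and "D \<ge> 0" "\<gamma> \<ge> 0"
    and \<beta>: "0 < \<beta>" "\<beta> \<le> 1" and r: "r > 0" and F: "F \<in> sets M" "measure M F > 0"
  shows "ambient_measure M (E \<inter> ((T ^^ n) -` F \<inter> space M)) / measure M F - ambient_measure M E
    \<le> ambient_measure M (open_nbhd (frontier E) r) + D * \<gamma> ^ n * (1 + r powr - \<beta>)"
proof (cases "E = {}")
  \<comment> \<open>As \<open>infdist x {} = 0\<close>, the tent function of the empty set is constantly 1.\<close>
  case True
  then show ?thesis
    using assms by (simp add: ambient_measure_def)
next
  case False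
  interpret prob_space M
    using mps by (simp add: measure_preserving_system_def)
  let ?f = "tent E r" and ?g = "indicator F :: 'a \<Rightarrow> real" and ?P = "(T ^^ n) -` F \<inter> space M"
  have Tn: "(T ^^ n) \<in> measurable M M"
    using mps by (intro measurable_funpow) (simp add: measure_preserving_system_def)
  have P: "?P \<in> sets M"
    using measurable_sets[OF Tn F(1)] .
  have EP: "E \<inter> ?P \<in> sets M"
  proof -
    have "E \<inter> ?P = (E \<inter> space M) \<inter> ?P" by blast
    with E P show ?thesis by (auto simp: ambient_measurable_def)
  qed
  have fm: "?f \<in> borel_measurable M"
    using mps r by (intro borel_measurable_tent)
  have gm: "(\<lambda>x. ?g ((T ^^ n) x)) \<in> borel_measurable M"
    using F by (intro measurable_compose[OF Tn]) simp
  have int: "integrable M (\<lambda>x. ?f x * ?g ((T ^^ n) x))"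
    using fm gm abs_tent_le_1[OF r, of E]
    by (intro integrable_const_bound[where B = 1]) (auto simp: indicator_def)
  have "measure M (E \<inter> ?P) = (\<integral>x. indicator (E \<inter> ?P) x \<partial>M)"
    using EP by simp
  also have "\<dots> \<le> (\<integral>x. ?f x * ?g ((T ^^ n) x) \<partial>M)"
  proof (intro integral_mono)
    show "integrable M (indicator (E \<inter> ?P) :: 'a \<Rightarrow> real)"
      using EP by (simp add: emeasure_eq_measure)
  qed (use int tent_nonneg[of E r] in \<open>auto simp: indicator_def tent_eq_1\<close>)
  also have "\<dots> \<le> (\<integral>x. ?f x \<partial>M) * measure M F
      + D * \<gamma> ^ n * holder_norm \<beta> (space M) ?f * measure M F"
  proof -
    have "integrable M ?g" using F by (simp add: emeasure_eq_measure)
    then have "\<bar>(\<integral>x. ?f x * ?g ((T ^^ n) x) \<partial>M) - (\<integral>x. ?f x \<partial>M) * (\<integral>x. ?g x \<partial>M)\<bar>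
        \<le> D * \<gamma> ^ n * holder_norm \<beta> (space M) ?f * (\<integral>x. \<bar>?g x\<bar> \<partial>M)"
      using corr tent_in_holder_space[OF r \<beta>] unfolding correlation_bound_def by blast
    then show ?thesis using F by simp
  qed
  finally have "measure M (E \<inter> ?P)
      \<le> ((\<integral>x. ?f x \<partial>M) + D * \<gamma> ^ n * holder_norm \<beta> (space M) ?f) * measure M F"
    by (simp add: algebra_simps)
  then have "measure M (E \<inter> ?P) / measure M F
      \<le> (\<integral>x. ?f x \<partial>M) + D * \<gamma> ^ n * holder_norm \<beta> (space M) ?f"
    using F by (simp add: divide_le_eq)
  moreover have "D * \<gamma> ^ n * holder_norm \<beta> (space M) ?f \<le> D * \<gamma> ^ n * (1 + r powr - \<beta>)"
    using holder_norm_tent_le[OF r \<beta> not_empty] assms by (intro mult_left_mono) auto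
  ultimately have "measure M (E \<inter> ?P) / measure M F - ambient_measure M E
      \<le> ambient_measure M (open_nbhd (frontier E) r) + D * \<gamma> ^ n * (1 + r powr - \<beta>)"
    using integral_tent_le[OF mps E r False] by linarith
  moreover have "ambient_measure M (E \<inter> ?P) = measure M (E \<inter> ?P)"
    by (auto simp: ambient_measure_def intro: arg_cong[where f = "measure M"])
  ultimately show ?thesis by (simp only:)
qed

text \<open>The upper bound applied to the complement of \<open>E\<close>, which has the same boundary, is the lower bound
  for \<open>E\<close>: both \<open>\<mu>(E) + \<mu>(-E) = 1\<close> and the corresponding identity for the conditional measure given
  the preimage of \<open>F\<close> hold. The latter uses that \<open>T\<close> preserves \<open>\<mu>\<close>, so that the preimage has
  measure \<open>\<mu>(F)\<close>.\<close>

lemma abs_measure_Int_preimage_le: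
  fixes M :: "'a::euclidean_space measure"
  assumes mps: "measure_preserving_system X M T" and E: "ambient_measurable M E"
    and corr: "correlation_bound M T \<beta> D \<gamma>" and "D \<ge> 0" "\<gamma> \<ge> 0"
    and \<beta>: "0 < \<beta>" "\<beta> \<le> 1" and r: "r > 0" and F: "F \<in> sets M" "measure M F > 0"
  shows "\<bar>ambient_measure M (E \<inter> ((T ^^ n) -` F \<inter> space M)) / measure M F - ambient_measure M E\<bar>
    \<le> ambient_measure M (open_nbhd (frontier E) r) + D * \<gamma> ^ n * (1 + r powr - \<beta>)"
proof -
  interpret prob_space M
    using mps by (simp add: measure_preserving_system_def)
  let ?P = "\<lambda>n. (T ^^ n) -` F \<inter> space M"
  have T: "T \<in> measurable M M"
    and pres: "\<And>A. A \<in> sets M \<Longrightarrow> emeasure M (T -` A \<inter> space M) = emeasure M A"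
    using mps by (auto simp: measure_preserving_system_def)
  have P: "?P n \<in> sets M" for n
    using measurable_sets[OF measurable_funpow[OF T] F(1)] .
  have PF: "measure M (?P n) = measure M F" for n
  proof (induction n)
    case 0
    then show ?case using sets.sets_into_space[OF F(1)] by (simp add: Int_absorb2)
  next
    case (Suc n)
    have "?P (Suc n) = T -` ?P n \<inter> space M"
      using measurable_space[OF T] by (auto simp: funpow_swap1)
    then have "measure M (?P (Suc n)) = measure M (?P n)"
      unfolding measure_def by (simp only: pres[OF P[of n]])
    with Suc show ?case by (simp only:)
  qed
  have E': "E \<inter> space M \<in> sets M" using E by (simp add: ambient_measurable_def)
  have cE: "- E \<inter> space M = space M - (E \<inter> space M)" by blast
  have c: "ambient_measurable M (- E)"
    using E' by (simp add: ambient_measurable_def cE)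
  have c1: "ambient_measure M (- E) = 1 - ambient_measure M E"
    using prob_compl[OF E'] by (simp add: ambient_measure_def cE)
  have c2: "ambient_measure M (- E \<inter> ?P n) = measure M F - ambient_measure M (E \<inter> ?P n)"
  proof -
    have "- E \<inter> ?P n \<inter> space M = ?P n - (E \<inter> space M)"
      "E \<inter> ?P n \<inter> space M = ?P n \<inter> (E \<inter> space M)" by auto
    then show ?thesis
      using finite_measure_Diff'[OF P[of n] E'] PF[of n] by (simp add: ambient_measure_def)
  qed
  have "ambient_measure M (- E \<inter> ?P n) / measure M F - ambient_measure M (- E)
      = - (ambient_measure M (E \<inter> ?P n) / measure M F - ambient_measure M E)"
    unfolding c1 c2 using F by (simp add: diff_divide_distrib)
  with measure_Int_preimage_le[OF mps E corr assms(4,5) \<beta> r F, of n]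
    measure_Int_preimage_le[OF mps c corr assms(4,5) \<beta> r F, of n]
  show ?thesis by (simp add: frontier_complement abs_le_iff)
qed

section \<open>Exponential mixing\<close>

text \<open>The balancing of the two error terms at the scale \<open>r = \<gamma> powr (n / (2 \<beta>))\<close>.\<close>

lemma balanced_scale:
  fixes \<gamma> \<beta> \<delta> B D :: real and n :: nat
  assumes "0 < \<gamma>" "\<gamma> < 1" "0 < \<beta>" "0 < \<delta>" "B \<ge> 0" "D \<ge> 0"
  defines "\<theta> \<equiv> max (\<gamma> powr (1 / 2)) (\<gamma> powr (\<delta> / (2 * \<beta>)))"
  shows "B * (\<gamma> powr (n / (2 * \<beta>))) powr \<delta> + D * \<gamma> ^ n * (1 + (\<gamma> powr (n / (2 * \<beta>))) powr - \<beta>)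
    \<le> (B + 2 * D) * \<theta> ^ n"
proof -
  have a: "(\<gamma> powr (n / (2 * \<beta>))) powr \<delta> = (\<gamma> powr (\<delta> / (2 * \<beta>))) ^ n"
    using assms by (simp add: powr_powr powr_power mult.commute)
  have b: "\<gamma> ^ n * (\<gamma> powr (n / (2 * \<beta>))) powr - \<beta> = (\<gamma> powr (1 / 2)) ^ n"
  proof -
    have "\<gamma> ^ n * (\<gamma> powr (n / (2 * \<beta>))) powr - \<beta> = \<gamma> powr n * \<gamma> powr (- (n / 2))"
      using assms by (simp add: powr_powr powr_realpow)
    also have "\<dots> = \<gamma> powr (n / 2)"
      by (simp flip: powr_add)
    finally show ?thesis using assms by (simp add: powr_power)
  qed
  have "\<gamma> powr 1 \<le> \<gamma> powr (1 / 2)"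
    using assms by (intro powr_mono') auto
  then have c: "\<gamma> ^ n \<le> \<theta> ^ n"
    using assms by (intro power_mono) (auto simp: \<theta>_def)
  have d: "(\<gamma> powr (\<delta> / (2 * \<beta>))) ^ n \<le> \<theta> ^ n" "(\<gamma> powr (1 / 2)) ^ n \<le> \<theta> ^ n"
    by (auto simp: \<theta>_def intro!: power_mono)
  have "B * (\<gamma> powr (\<delta> / (2 * \<beta>))) ^ n + D * (\<gamma> ^ n + (\<gamma> powr (1 / 2)) ^ n)
      \<le> B * \<theta> ^ n + D * (\<theta> ^ n + \<theta> ^ n)"
    using c d assms by (intro add_mono mult_left_mono) auto
  then show ?thesis
    unfolding a using b by (simp add: algebra_simps)
qed

theorem theorem1p2:
  fixes X :: "(real ^ 'd) set"
    and M :: "(real ^ 'd) measure"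
    and T :: "real ^ 'd \<Rightarrow> real ^ 'd"
    and \<C> :: "(real ^ 'd) set set"
    and \<beta> :: real
  assumes "bounded X"
    and "measure_preserving_system X M T"
    and "0 < \<beta>" and "\<beta> \<le> 1"
    and "exp_decay_of_correlations M T \<beta>"
    and "\<forall>E\<in>\<C>. ambient_measurable M E"
    and "\<exists>C>0. \<exists>\<delta>>0. \<forall>\<rho>>0. \<forall>E\<in>\<C>.
           ambient_measure M (open_nbhd (frontier E) \<rho>) \<le> C * \<rho> powr \<delta>"
  shows "exp_mixing M T \<C>"
proof -
  obtain D \<gamma> where D: "D > 0" and \<gamma>: "0 < \<gamma>" "\<gamma> < 1" and corr: "correlation_bound M T \<beta> D \<gamma>"
    using assms(5) unfolding exp_decay_of_correlations_def correlation_bound_def by blast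
  obtain B \<delta> where B: "B > 0" and \<delta>: "\<delta> > 0"
    and boundary: "\<And>\<rho> E. \<rho> > 0 \<Longrightarrow> E \<in> \<C> \<Longrightarrow>
      ambient_measure M (open_nbhd (frontier E) \<rho>) \<le> B * \<rho> powr \<delta>"
    using assms(7) by blast
  define \<theta> where "\<theta> = max (\<gamma> powr (1 / 2)) (\<gamma> powr (\<delta> / (2 * \<beta>)))"
  have \<theta>: "0 < \<theta>" "\<theta> < 1"
    using \<gamma> \<delta> assms(3) powr_less_mono2[of _ \<gamma> 1] by (auto simp: \<theta>_def less_max_iff_disj)
  have bound: "q \<le> (B + 2 * D) * \<theta> ^ n"
    if "q \<in> insert 0
       {\<bar>ambient_measure M (E \<inter> ((T ^^ n) -` F \<inter> space M)) / measure M F - ambient_measure M E\<bar>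
        | E F. E \<in> \<C> \<and> F \<in> sets M \<and> measure M F > 0}" for q and n :: nat
    using that
  proof (elim insertE CollectE exE conjE)
    fix E F
    assume q: "q = \<bar>ambient_measure M (E \<inter> ((T ^^ n) -` F \<inter> space M)) / measure M F
        - ambient_measure M E\<bar>"
      and E: "E \<in> \<C>" and F: "F \<in> sets M" "measure M F > 0"
    define r where "r = \<gamma> powr (n / (2 * \<beta>))"
    have r: "r > 0" using \<gamma> by (simp add: r_def)
    have "q \<le> ambient_measure M (open_nbhd (frontier E) r) + D * \<gamma> ^ n * (1 + r powr - \<beta>)"
      unfolding q using assms(6) E D \<gamma>
      by (intro abs_measure_Int_preimage_le[OF assms(2) _ corr _ _ assms(3,4) r F]) auto
    also have "\<dots> \<le> B * r powr \<delta> + D * \<gamma> ^ n * (1 + r powr - \<beta>)"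
      using boundary[OF r E] by simp
    also have "\<dots> \<le> (B + 2 * D) * \<theta> ^ n"
      unfolding r_def \<theta>_def using \<gamma> \<delta> B D assms(3) by (intro balanced_scale) auto
    finally show ?thesis .
  qed (use B D \<theta> in simp)
  have "norm (mixing_coeff M T \<C> n) \<le> (B + 2 * D) * norm (\<theta> ^ n)" for n
  proof -
    have "mixing_coeff M T \<C> n \<le> (B + 2 * D) * \<theta> ^ n"
      unfolding mixing_coeff_def by (rule cSup_least) (use bound in auto)
    moreover have "0 \<le> mixing_coeff M T \<C> n"
      unfolding mixing_coeff_def
      by (rule cSup_upper) (use bound[of _ n] in \<open>auto intro!: bdd_aboveI\<close>)
    ultimately show ?thesis using \<theta> by simp
  qed
  then have "mixing_coeff M T \<C> \<in> O(\<lambda>n. \<theta> ^ n)"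
    by (intro bigoI always_eventually allI)
  with \<theta> show ?thesis unfolding exp_mixing_def by blast
qed

end
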